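(* For every constant $C>0$ there is a function $q:\mathbb{R}_+\times\mathbb{N}\to\mathbb{N}$ such that for every $\varepsilon>0$ there is a deterministic $(\varepsilon,q(\varepsilon,d))$-local sparse spanning graph algorithm for the family of $f$-non-expanding graphs, where $$f(x)=\frac{C}{\log x\cdot(\log\log x)^2},$$ and $d$ is the degree bound given as input to the algorithm.
   Context: All logarithms are base $2$. For a graph $H$ and $S\subseteq V(H)$, $\partial_H(S)$ denotes the set of edges of $H$ with exactly one endpoint in $S$, and the (edge) expansion of $H$ is $\phi_H=\min_S |\partial_H(S)|/|S|$, the minimum over all $S\subseteq V(H)$ with $1\le |S|\le |V(H)|/2$. A graph $G$ is $f$-non-expanding if every subgraph $H$ of $G$ on $t>2$ vertices satisfies $\phi_H\le f(t)$. Input model: the algorithm receives integers $n,d\ge1$ and oracle access to the incidence-list representation of a graph $G=(V,E)$ with vertex set (ids) $\{1,\dots,n\}$ and maximum degree at most $d$: each vertex has an ordered list of its neighbours, and a query $(v,i)$ with $1\le v\le n$, $1\le i\le d$ returns the $i$-th neighbour of $v$ or an indication that $v$ has fewer than $i$ neighbours. An algorithm $\mathcal{A}$ is an $(\varepsilon,q)$-local sparse spanning graph algorithm if, given $n,d$ and oracle access to a connected $n$-vertex graph $G=(V,E)$ of maximum degree at most $d$, it provides query access to a subgraph $G'=(V,E')$ of $G$, meaning that on input an edge $(u,v)\in E$ it answers whether $(u,v)\in E'$, with the answers to any sequence of queries consistent with the same $G'$, and such that: (i) $G'$ is connected; (ii) $|E'|<(1+\varepsilon)n$ with probability at least $2/3$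 over the internal randomness of $\mathcal{A}$; (iii) $E'$ is determined by $G$ and the internal randomness of $\mathcal{A}$; (iv) $\mathcal{A}$ makes at most $q$ queries to $G$ (for each edge it is queried on). It is such an algorithm for a family of graphs $\mathcal{C}$ if these conditions hold whenever the input graph belongs to $\mathcal{C}$. *)

theory Defs
  imports "HOL-Probability.Probability"
begin

section \<open>Finite simple graphs and expansion\<close>

record 'a ugraph =
  vertices :: "'a set"
  edges :: "'a set set"

definition simple_graph :: "'a ugraph \<Rightarrow> bool" where
  "simple_graph G \<longleftrightarrow>
     finite (vertices G) \<and> (\<forall>e\<in>edges G. e \<subseteq> vertices G \<and> card e = 2)"

definition subgraph :: "'a ugraph \<Rightarrow> 'a ugraph \<Rightarrow> bool" where
  "subgraph H G \<longleftrightarrow>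
     simple_graph H \<and> vertices H \<subseteq> vertices G \<and> edges H \<subseteq> edges G"

definition connected_graph :: "'a ugraph \<Rightarrow> bool" where
  "connected_graph G \<longleftrightarrow>
     (\<forall>u\<in>vertices G. \<forall>v\<in>vertices G. (u, v) \<in> {(x, y). {x, y} \<in> edges G}\<^sup>*)"

definition neighbours :: "'a ugraph \<Rightarrow> 'a \<Rightarrow> 'a set" where
  "neighbours G v = {u. {v, u} \<in> edges G}"

definition max_degree_at_most :: "'a ugraph \<Rightarrow> nat \<Rightarrow> bool" where
  "max_degree_at_most G d \<longleftrightarrow> (\<forall>v\<in>vertices G. card (neighbours G v) \<le> d)"

definition edge_boundary :: "'a ugraph \<Rightarrow> 'a set \<Rightarrow> 'a set set" where
  "edge_boundary H S = {e \<in> edges H. card (e \<inter> S) = 1}"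

text \<open>The minimum ranges over a nonempty set as soon as \<open>H\<close> has at least two vertices.\<close>

definition expansion :: "'a ugraph \<Rightarrow> real" where
  "expansion H =
     Min ((\<lambda>S. real (card (edge_boundary H S)) / real (card S)) `
       {S. S \<subseteq> vertices H \<and> 1 \<le> card S \<and> real (card S) \<le> real (card (vertices H)) / 2})"

definition non_expanding :: "(real \<Rightarrow> real) \<Rightarrow> 'a ugraph \<Rightarrow> bool" where
  "non_expanding f G \<longleftrightarrow>
     (\<forall>H. subgraph H G \<and> card (vertices H) > 2 \<longrightarrow>
        expansion H \<le> f (real (card (vertices H))))"

section \<open>Oracle access to incidence lists\<close>

definition incidence_lists :: "nat ugraph \<Rightarrow> (nat \<Rightarrow> nat list) \<Rightarrow> bool" where
  "incidence_lists G adj \<longleftrightarrow>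
     (\<forall>v\<in>vertices G. distinct (adj v) \<and> set (adj v) = neighbours G v)"

type_synonym graph_oracle = "nat \<Rightarrow> nat \<Rightarrow> nat option"

definition incidence_oracle :: "(nat \<Rightarrow> nat list) \<Rightarrow> graph_oracle" where
  "incidence_oracle adj v i =
     (if 1 \<le> i \<and> i \<le> length (adj v) then Some (adj v ! (i - 1)) else None)"

text \<open>
  An adaptive computation with oracle access is a decision tree: it either stops with an
  answer, or poses a query \<open>(v, i)\<close> and continues depending on the reply. As usual for query
  complexity, computation between queries is free.
\<close>

datatype computation = Answer bool | Query nat nat "nat option \<Rightarrow> computation"

primrec answer :: "graph_oracle \<Rightarrow> computation \<Rightarrow> bool" where
  "answer orc (Answer b) = b"
| "answer orc (Query v i k) = answer orc (k (orc v i))"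

primrec queries :: "graph_oracle \<Rightarrow> computation \<Rightarrow> (nat \<times> nat) list" where
  "queries orc (Answer b) = []"
| "queries orc (Query v i k) = (v, i) # queries orc (k (orc v i))"

section \<open>Local sparse spanning graph algorithms\<close>

text \<open>The internal randomness is an infinite sequence of independent fair coin tosses.\<close>

type_synonym coins = "nat \<Rightarrow> bool"

definition coin_space :: "coins measure" where
  "coin_space = (\<Pi>\<^sub>M i\<in>UNIV. measure_pmf (bernoulli_pmf (1 / 2)))"

text \<open>
  An algorithm receives its coins, \<open>n\<close>, \<open>d\<close> and the edge \<open>(u, v)\<close> it is asked about.
\<close>

type_synonym local_algorithm = "coins \<Rightarrow> nat \<Rightarrow> nat \<Rightarrow> nat \<times> nat \<Rightarrow> computation"

definition deterministic :: "local_algorithm \<Rightarrow> bool" where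
  "deterministic A \<longleftrightarrow> (\<forall>\<omega> \<omega>'. A \<omega> = A \<omega>')"

text \<open>
  The query bound \<open>q\<close> may depend on the degree bound \<open>d\<close>, but not on \<open>n\<close>. The edge set \<open>E' \<omega>\<close>
  is chosen before the incidence lists \<open>adj\<close> and before the queried edge: for given inputs \<open>n\<close>
  and \<open>d\<close> it is determined by the graph and the coins alone, and all answers, including those
  for the two orientations \<open>(u, v)\<close> and \<open>(v, u)\<close> of an edge, are consistent with it.
\<close>

definition local_sparse_spanning_graph_algorithm ::
    "real \<Rightarrow> (nat \<Rightarrow> nat) \<Rightarrow> nat ugraph set \<Rightarrow> local_algorithm \<Rightarrow> bool" where
  "local_sparse_spanning_graph_algorithm \<epsilon> q \<C> A \<longleftrightarrow>
     (\<forall>n\<ge>1. \<forall>d\<ge>1. \<forall>G\<in>\<C>.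
        simple_graph G \<and> vertices G = {1..n} \<and> connected_graph G \<and> max_degree_at_most G d \<longrightarrow>
        (\<exists>E' :: coins \<Rightarrow> nat set set.
           (\<forall>\<omega>. E' \<omega> \<subseteq> edges G \<and>
                connected_graph \<lparr>vertices = {1..n}, edges = E' \<omega>\<rparr>) \<and>
           measure coin_space {\<omega>. real (card (E' \<omega>)) < (1 + \<epsilon>) * real n} \<ge> 2 / 3 \<and>
           (\<forall>\<omega> adj u v. incidence_lists G adj \<and> {u, v} \<in> edges G \<longrightarrow>
              (let orc = incidence_oracle adj; T = A \<omega> n d (u, v) in
                 (answer orc T \<longleftrightarrow> {u, v} \<in> E' \<omega>) \<and>
                 set (queries orc T) \<subseteq> {1..n} \<times> {1..d} \<and>
                 length (queries orc T) \<le> q d))))"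

end

theory Submission
  imports Defs
begin

text \<open>
  Fix a linear order on the possible edges and delete an edge \<open>{u, v}\<close> whenever \<open>u\<close> and \<open>v\<close> are
  joined by a walk of length at most \<open>k\<close> using only smaller edges; this is decided by exploring
  the ball of radius \<open>k\<close> around \<open>u\<close>. As in Kruskal's algorithm, connectivity is preserved, and
  the surviving graph induces a forest on every set of few vertices. A non-expanding graph can be
  cut repeatedly along sparse cuts until all pieces have bounded size. With
  \<open>P t = C / log (log t)\<close>, the expansion bound satisfies \<open>f t \<le> P (t / 2) - P t\<close>, so the number
  of cut edges telescopes to at most \<open>P s\<close> per vertex when pieces of at most \<open>2 s\<close> vertices are
  left uncut. As \<open>P s\<close> tends to \<open>0\<close>, a suitable \<open>s\<close> depending only on \<open>C\<close> and \<open>\<epsilon>\<close> suffices.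
\<close>

section \<open>Deleting edges that close a short walk\<close>

text \<open>\<open>set_encode\<close> is injective on finite sets, so comparing codes orders finite
  edges without ties. Edges become a symmetric relation, so that walks are relational
  powers.\<close>

definition light_arcs :: "nat set set \<Rightarrow> nat \<Rightarrow> (nat \<times> nat) set" where
  "light_arcs F r = {(x, y). {x, y} \<in> F \<and> set_encode {x, y} < r}"

text \<open>The reflexive closure turns the \<open>k\<close>-th power into walks of length at most
  \<open>k\<close>. Quantifying over both orientations makes the test a property of the edge
  itself.\<close>

definition sparsify :: "nat \<Rightarrow> nat set set \<Rightarrow> nat set set" where
  "sparsify k F =
     {e \<in> F. \<forall>u v. e = {u, v} \<longrightarrow> (u, v) \<notin> (light_arcs F (set_encode e))\<^sup>= ^^ k}"

lemma sparsify_subset: "sparsify k F \<subseteq> F"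
  by (auto simp: sparsify_def)

lemma sym_light_arcs: "sym (light_arcs F r)"
  by (auto simp: sym_def light_arcs_def insert_commute)

lemma light_arcs_mono: "F \<subseteq> F' \<Longrightarrow> r \<le> r' \<Longrightarrow> light_arcs F r \<subseteq> light_arcs F' r'"
  by (auto simp: light_arcs_def)

lemma sym_relpow: "sym R \<Longrightarrow> sym (R ^^ k)"
proof (induction k)
  case (Suc k)
  have "(R ^^ Suc k)\<inverse> = R\<inverse> O (R ^^ k)\<inverse>"
    by (simp add: converse_relcomp)
  also have "\<dots> = R ^^ Suc k"
    using Suc by (simp add: sym_conv_converse_eq relpow_commute)
  finally show ?case
    by (simp add: sym_conv_converse_eq)
qed (auto simp: sym_def)

lemma relpow_subset_reflcl_relpow:
  assumes "R \<subseteq> R'" "j \<le> k"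
  shows "R ^^ j \<subseteq> R'\<^sup>= ^^ k"
proof -
  have "R ^^ j \<subseteq> R'\<^sup>= ^^ j"
    using assms(1) by (induction j) (simp, simp only: relpow.simps, blast)
  also have "\<dots> \<subseteq> R'\<^sup>= ^^ k"
    using assms(2) by (induction k rule: dec_induct) auto
  finally show ?thesis .
qed

lemma sparsify_iff:
  "{u, v} \<in> sparsify k F \<longleftrightarrow>
     {u, v} \<in> F \<and> (u, v) \<notin> (light_arcs F (set_encode {u, v}))\<^sup>= ^^ k"
proof -
  have "sym ((light_arcs F (set_encode {u, v}))\<^sup>= ^^ k)"
    by (intro sym_relpow sym_Un sym_light_arcs sym_Id)
  then show ?thesis
    by (auto simp: sparsify_def doubleton_eq_iff insert_commute dest: symD)
qed

text \<open>Induction on the code of the edge: a deleted edge is bypassed by a walk of lighter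
  edges, and the endpoints of each of these are joined in the sparsified graph by induction.\<close>

lemma arc_in_rtrancl_sparsify:
  assumes "{u, v} \<in> F"
  shows "(u, v) \<in> {(x, y). {x, y} \<in> sparsify k F}\<^sup>*"
  using assms
proof (induction "set_encode {u, v}" arbitrary: u v rule: less_induct)
  case less
  let ?R = "light_arcs F (set_encode {u, v})"
  show ?case
  proof (cases "{u, v} \<in> sparsify k F")
    case False
    then have "(u, v) \<in> ?R\<^sup>= ^^ k"
      using less.prems by (simp add: sparsify_iff)
    then have "(u, v) \<in> ?R\<^sup>*"
      by (metis relpow_imp_rtrancl rtrancl_reflcl)
    moreover have "?R \<subseteq> {(x, y). {x, y} \<in> sparsify k F}\<^sup>*"
      using less.hyps by (auto simp: light_arcs_def)
    ultimately show ?thesis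
      using rtrancl_subset_rtrancl by blast
  qed auto
qed

lemma connected_graph_sparsify:
  assumes "connected_graph G"
  shows "connected_graph \<lparr>vertices = vertices G, edges = sparsify k (edges G)\<rparr>"
proof -
  have "{(x, y). {x, y} \<in> edges G} \<subseteq> {(x, y). {x, y} \<in> sparsify k (edges G)}\<^sup>*"
    using arc_in_rtrancl_sparsify by blast
  then have "{(x, y). {x, y} \<in> edges G}\<^sup>* \<subseteq> {(x, y). {x, y} \<in> sparsify k (edges G)}\<^sup>*"
    by (rule rtrancl_subset_rtrancl)
  then show ?thesis
    using assms by (simp add: connected_graph_def subset_iff)
qed

text \<open>
  Adding the edges in increasing order, each edge merges two components, so that the larger one
  of their two minimal vertices is never again minimal in its component. This maps the edges
  injectively to vertices.
\<close>

lemma card_edges_le_card_vertices: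
  assumes "finite W"
    and F: "\<And>e. e \<in> F \<Longrightarrow> e \<subseteq> W \<and> card e = 2"
    and acyclic: "\<And>u v. {u, v} \<in> F \<Longrightarrow> (u, v) \<notin> (light_arcs F (set_encode {u, v}))\<^sup>*"
  shows "card F \<le> card W"
proof -
  \<comment> \<open>\<open>K r x\<close> is the component of \<open>x\<close> in \<open>W\<close>
    when only edges with code below \<open>r\<close> are present, \<open>rt r x\<close> is its least
    vertex, and \<open>m e\<close> is the larger of the two least vertices whose components
    \<open>e\<close> merges.\<close>
  define K where "K r x = {y \<in> W. (x, y) \<in> (light_arcs F r)\<^sup>*}" for r x
  define rt where "rt r x = Min (K r x)" for r x
  define m where "m e = Max (rt (set_encode e) ` e)" for e
  have fin_e: "finite e" if "e \<in> F" for e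
    using F[OF that] \<open>finite W\<close> finite_subset by blast
  have symK: "(y, x) \<in> (light_arcs F r)\<^sup>*" if "(x, y) \<in> (light_arcs F r)\<^sup>*" for x y r
    using that sym_light_arcs[of F r] sym_rtrancl symD by metis
  have finK: "finite (K r x)" for r x
    using \<open>finite W\<close> by (simp add: K_def)
  have rt_in: "rt r x \<in> K r x" if "x \<in> W" for r x
  proof -
    have "x \<in> K r x"
      using that by (simp add: K_def)
    then show ?thesis
      unfolding rt_def using finK Min_in by blast
  qed
  have rt_le: "rt r x \<le> y" if "y \<in> K r x" for r x y
    using that finK by (simp add: rt_def)
  have m_cases: "\<exists>u v. e = {u, v} \<and> rt (set_encode e) v < rt (set_encode e) u
      \<and> m e = rt (set_encode e) u" if "e \<in> F" for e
  proof -
    obtain u v where e: "e = {u, v}"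
      using F[OF \<open>e \<in> F\<close>] by (auto simp: card_2_iff)
    then have W: "u \<in> W" "v \<in> W"
      using F[OF that] by auto
    have "rt (set_encode e) u \<noteq> rt (set_encode e) v"
    proof
      assume "rt (set_encode e) u = rt (set_encode e) v"
      then have "(u, v) \<in> (light_arcs F (set_encode e))\<^sup>*"
        using rt_in[OF W(1), of "set_encode e"] rt_in[OF W(2), of "set_encode e"] symK
        unfolding K_def by (metis (mono_tags, lifting) mem_Collect_eq rtrancl_trans)
      then show False
        using acyclic that e by blast
    qed
    then consider "rt (set_encode e) v < rt (set_encode e) u"
      | "rt (set_encode e) u < rt (set_encode e) v"
      by linarith
    then show ?thesis
    proof cases
      case 1
      then show ?thesis using e by (intro exI[of _ u] exI[of _ v]) (auto simp: m_def max_def)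
    next
      case 2
      then show ?thesis using e by (intro exI[of _ v] exI[of _ u]) (auto simp: m_def max_def)
    qed
  qed
  have m_neq: "m e \<noteq> m e'"
    if "e \<in> F" "e' \<in> F" and less: "set_encode e < set_encode e'" for e e'
  proof
    assume eq: "m e = m e'"
    obtain u v where e: "e = {u, v}" and lt: "rt (set_encode e) v < rt (set_encode e) u"
      and m: "m e = rt (set_encode e) u"
      using m_cases[OF \<open>e \<in> F\<close>] by blast
    obtain x where x: "x \<in> e'" "m e' = rt (set_encode e') x"
      using m_cases[OF \<open>e' \<in> F\<close>] by blast
    let ?R = "light_arcs F (set_encode e)" and ?R' = "light_arcs F (set_encode e')"
    have W: "u \<in> W" "v \<in> W" "x \<in> W"
      using F[OF \<open>e \<in> F\<close>] F[OF \<open>e' \<in> F\<close>] e x(1) by auto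
    have sub: "?R\<^sup>* \<subseteq> ?R'\<^sup>*"
      using less by (intro rtrancl_mono light_arcs_mono) auto
    \<comment> \<open>By the time of \<open>e'\<close>, the edge \<open>e\<close> has joined
      \<open>m e\<close> to the smaller vertex \<open>rt (set_encode e) v\<close>, so
      \<open>m e\<close> can no longer be the least vertex of the component of
      \<open>x\<close>.\<close>
    have "(x, m e) \<in> ?R'\<^sup>*"
      using rt_in[OF W(3), of "set_encode e'"] x(2) eq by (simp add: K_def)
    moreover have "(m e, u) \<in> ?R'\<^sup>*"
      using rt_in[OF W(1), of "set_encode e"] m sub symK by (auto simp: K_def)
    moreover have "(u, v) \<in> ?R'\<^sup>*"
      using less e \<open>e \<in> F\<close> by (auto simp: light_arcs_def)
    moreover have "(v, rt (set_encode e) v) \<in> ?R'\<^sup>*"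
      using rt_in[OF W(2), of "set_encode e"] sub by (auto simp: K_def)
    ultimately have "(x, rt (set_encode e) v) \<in> ?R'\<^sup>*"
      by (blast intro: rtrancl_trans)
    then have "rt (set_encode e) v \<in> K (set_encode e') x"
      using rt_in[OF W(2), of "set_encode e"] by (simp add: K_def)
    then show False
      using rt_le x(2) eq lt m by fastforce
  qed
  have "inj_on m F"
  proof (rule inj_onI, rule ccontr)
    fix e e' assume *: "e \<in> F" "e' \<in> F" "m e = m e'" "e \<noteq> e'"
    then have "set_encode e \<noteq> set_encode e'"
      using fin_e set_encode_eq by blast
    then show False
      using m_neq * by (metis linorder_neqE_nat)
  qed
  moreover have "m ` F \<subseteq> W"
  proof
    fix z assume "z \<in> m ` F"
    then obtain e where "e \<in> F" "z = m e" by blast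
    then obtain u where "u \<in> e" "z = rt (set_encode e) u"
      using m_cases by blast
    then show "z \<in> W"
      using rt_in F[OF \<open>e \<in> F\<close>] by (auto simp: K_def)
  qed
  ultimately show ?thesis
    using \<open>finite W\<close> card_inj_on_le by blast
qed

text \<open>
  The exponent is quadratic in the number of vertices because the length of a walk is bounded
  by the number of arcs it can use.
\<close>

lemma card_sparsify_small:
  assumes "finite W" and F: "\<And>e. e \<in> F \<Longrightarrow> card e = 2" and "(card W)\<^sup>2 \<le> k"
  shows "card {e \<in> sparsify k F. e \<subseteq> W} \<le> card W"
proof (rule card_edges_le_card_vertices[OF \<open>finite W\<close>])
  let ?F = "{e \<in> sparsify k F. e \<subseteq> W}"
  show "e \<subseteq> W \<and> card e = 2" if "e \<in> ?F" for e
    using that F sparsify_subset by auto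
  fix u v assume uv: "{u, v} \<in> ?F"
  let ?R = "light_arcs ?F (set_encode {u, v})" and ?R' = "light_arcs F (set_encode {u, v})"
  show "(u, v) \<notin> ?R\<^sup>*"
  proof
    have R: "?R \<subseteq> W \<times> W"
      by (auto simp: light_arcs_def)
    then have fin: "finite ?R"
      using \<open>finite W\<close> finite_subset by blast
    have "card ?R \<le> card (W \<times> W)"
      using R \<open>finite W\<close> by (intro card_mono) auto
    then have cardR: "card ?R \<le> k"
      using assms(3) by (simp add: card_cartesian_product power2_eq_square)
    assume "(u, v) \<in> ?R\<^sup>*"
    then obtain j where "j \<le> card ?R" "(u, v) \<in> ?R ^^ j"
      using rtrancl_finite_eq_relpow[OF fin] by auto
    \<comment> \<open>Walks inside \<open>W\<close> are walks in \<open>F\<close>, and idle steps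
      pad them to length exactly \<open>k\<close>.\<close>
    moreover have "?R ^^ j \<subseteq> ?R'\<^sup>= ^^ k"
      using cardR \<open>j \<le> card ?R\<close> sparsify_subset
      by (intro relpow_subset_reflcl_relpow light_arcs_mono) auto
    ultimately show False
      using uv by (auto simp: sparsify_iff)
  qed
qed

section \<open>Sparse cuts\<close>

text \<open>Halving \<open>t\<close> lowers \<open>x = log 2 t\<close> by one, so the right side is
  a unit difference of the function \<open>C / log 2 x\<close>. Up to the factor
  \<open>ln 2\<close>, the left side is the absolute value of its derivative at
  \<open>x\<close>.\<close>

lemma expansion_bound_telescopes:
  fixes t C :: real
  assumes "C > 0" "t > 4"
  shows "C / (log 2 t * (log 2 (log 2 t))\<^sup>2)
           \<le> C / log 2 (log 2 (t / 2)) - C / log 2 (log 2 t)"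
proof -
  define x where "x = log 2 t"
  have "x > 2"
    using assms(2) by (simp add: x_def less_log_iff)
  have x1: "log 2 (t / 2) = x - 1"
    using assms(2) by (simp add: x_def log_divide)
  define a b where "a = log 2 (x - 1)" and "b = log 2 x"
  have "a > 0" "a \<le> b" "b > 0"
    using \<open>x > 2\<close> by (auto simp: a_def b_def)
  have "1 / x \<le> b - a"
  proof -
    have "ln (x - 1) \<le> ln x - 1 / x"
      using ln_le_minus_one[of "(x - 1) / x"] \<open>x > 2\<close> by (simp add: ln_div field_simps)
    then have "1 / x \<le> ln x - ln (x - 1)" by simp
    also have "\<dots> \<le> (ln x - ln (x - 1)) / ln 2"
      using \<open>x > 2\<close> ln_2_less_1 by (simp add: le_divide_eq mult_left_le)
    finally show ?thesis
      by (simp add: a_def b_def log_def diff_divide_distrib)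
  qed
  then have "1 / (x * b\<^sup>2) \<le> (b - a) / b\<^sup>2"
    using \<open>b > 0\<close> divide_right_mono[of "1 / x" "b - a" "b\<^sup>2"] by simp
  \<comment> \<open>Replacing one factor \<open>b\<close> by the smaller \<open>a\<close> lets the
    quotient split into partial fractions.\<close>
  also have "\<dots> \<le> (b - a) / (a * b)"
    using \<open>a > 0\<close> \<open>a \<le> b\<close> by (intro divide_left_mono) (auto simp: power2_eq_square)
  also have "\<dots> = 1 / a - 1 / b"
    using \<open>a > 0\<close> \<open>b > 0\<close> by (simp add: field_simps)
  finally have "C * (1 / (x * b\<^sup>2)) \<le> C * (1 / a - 1 / b)"
    using assms(1) by (intro mult_left_mono) auto
  then show ?thesis
    unfolding x1 by (simp add: a_def b_def x_def right_diff_distrib)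
qed

text \<open>Non-expansion speaks of all subgraphs, not only induced ones, so it applies to the edges
  of \<open>F\<close> inside \<open>W\<close>. The minimum defining the expansion is attained, as it
  ranges over a finite family that contains the singletons.\<close>

lemma non_expanding_sparse_cut:
  assumes ne: "non_expanding f G" and "simple_graph G"
    and "W \<subseteq> vertices G" "F \<subseteq> edges G" "card W > 2"
  obtains S where "S \<subseteq> W" "1 \<le> card S" "real (card S) \<le> real (card W) / 2"
    "real (card {e \<in> F. e \<subseteq> W \<and> card (e \<inter> S) = 1}) \<le> f (real (card W)) * real (card S)"
proof -
  define H where "H = \<lparr>vertices = W, edges = {e \<in> F. e \<subseteq> W}\<rparr>"
  define \<S> where "\<S> = {S. S \<subseteq> W \<and> 1 \<le> card S \<and> real (card S) \<le> real (card W) / 2}"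
  define r where "r S = real (card (edge_boundary H S)) / real (card S)" for S
  have "finite W"
    using assms(5) card.infinite by fastforce
  have "subgraph H G"
    using assms \<open>finite W\<close> by (auto simp: subgraph_def simple_graph_def H_def)
  then have "expansion H \<le> f (real (card W))"
    using ne assms(5) by (auto simp: non_expanding_def H_def)
  have "expansion H = Min (r ` \<S>)"
    by (simp add: expansion_def r_def \<S>_def H_def)
  moreover have "finite \<S>"
    using \<open>finite W\<close> by (simp add: \<S>_def)
  moreover have "\<S> \<noteq> {}"
  proof -
    obtain w where "w \<in> W"
      using assms(5) by fastforce
    then have "{w} \<in> \<S>"
      using assms(5) by (simp add: \<S>_def)
    then show ?thesis by blast
  qed
  ultimately have "expansion H \<in> r ` \<S>"
    using Min_in by simp
  then obtain S where S: "S \<in> \<S>" "r S \<le> f (real (card W))"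
    using \<open>expansion H \<le> f (real (card W))\<close> by auto
  then have "real (card (edge_boundary H S)) \<le> f (real (card W)) * real (card S)"
    by (simp add: r_def \<S>_def divide_le_eq)
  moreover have "edge_boundary H S = {e \<in> F. e \<subseteq> W \<and> card (e \<inter> S) = 1}"
    by (auto simp: edge_boundary_def H_def)
  ultimately show ?thesis
    using S that by (auto simp: \<S>_def)
qed

lemma card_induced_edges_split:
  assumes "finite F" "\<And>e. e \<in> F \<Longrightarrow> card e = 2"
  shows "card {e \<in> F. e \<subseteq> W} \<le> card {e \<in> F. e \<subseteq> S} + card {e \<in> F. e \<subseteq> W - S}
           + card {e \<in> F. e \<subseteq> W \<and> card (e \<inter> S) = 1}"
proof -
  have "e \<subseteq> S \<or> e \<subseteq> W - S \<or> card (e \<inter> S) = 1" if "e \<in> F" "e \<subseteq> W" for e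
  proof -
    obtain x y where "e = {x, y}" "x \<noteq> y"
      using assms(2)[OF \<open>e \<in> F\<close>] by (auto simp: card_2_iff)
    then show ?thesis
      using that(2) by (cases "x \<in> S"; cases "y \<in> S") auto
  qed
  then have "{e \<in> F. e \<subseteq> W} \<subseteq> ({e \<in> F. e \<subseteq> S} \<union> {e \<in> F. e \<subseteq> W - S})
      \<union> {e \<in> F. e \<subseteq> W \<and> card (e \<inter> S) = 1}"
    by blast
  then have "card {e \<in> F. e \<subseteq> W} \<le> card (({e \<in> F. e \<subseteq> S} \<union> {e \<in> F. e \<subseteq> W - S})
      \<union> {e \<in> F. e \<subseteq> W \<and> card (e \<inter> S) = 1})"
    using assms(1) by (intro card_mono) auto
  also have "\<dots> \<le> card {e \<in> F. e \<subseteq> S} + card {e \<in> F. e \<subseteq> W - S}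
           + card {e \<in> F. e \<subseteq> W \<and> card (e \<inter> S) = 1}"
    by (meson add_le_mono1 card_Un_le le_trans)
  finally show ?thesis .
qed

text \<open>Strong induction on the size of \<open>W\<close>. The edges of a sparse cut are charged
  to its smaller side \<open>S\<close>, whose size is at least halved by the cut;
  \<open>tele\<close> says that the growth of the allowance from \<open>?t / 2\<close> to
  \<open>?t\<close> pays for this charge.\<close>

lemma card_edges_non_expanding:
  fixes P :: "real \<Rightarrow> real"
  assumes ne: "non_expanding f G" and G: "simple_graph G" and F: "F \<subseteq> edges G"
    and "s \<ge> 1"
    and small: "\<And>W. W \<subseteq> vertices G \<Longrightarrow> real (card W) \<le> 2 * s \<Longrightarrow>
                  card {e \<in> F. e \<subseteq> W} \<le> card W"
    and anti: "\<And>x y. s \<le> x \<Longrightarrow> x \<le> y \<Longrightarrow> P y \<le> P x"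
    and tele: "\<And>t. t > 2 * s \<Longrightarrow> f t \<le> P (t / 2) - P t"
    and W: "W \<subseteq> vertices G"
  shows "real (card {e \<in> F. e \<subseteq> W})
           \<le> real (card W) * (1 + (P s - P (max s (real (card W)))))"
  using W
proof (induction "card W" arbitrary: W rule: less_induct)
  case less
  \<comment> \<open>\<open>g w\<close> is the allowance per vertex for cut edges in a set of size
    \<open>w\<close>. The maximum keeps the argument of \<open>P\<close> in the range where
    \<open>P\<close> is known to be antitone.\<close>
  define g where "g w = P s - P (max s w)" for w
  have g_mono: "g x \<le> g y" if "x \<le> y" for x y
    using that anti[of "max s x" "max s y"] by (auto simp: g_def)
  have g_nonneg: "g x \<ge> 0" for x
    using anti[of s "max s x"] by (simp add: g_def)
  have finV: "finite (vertices G)" and two: "\<And>e. e \<in> F \<Longrightarrow> card e = 2"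
    and sub: "\<And>e. e \<in> F \<Longrightarrow> e \<subseteq> vertices G"
    using G F by (auto simp: simple_graph_def)
  have finF: "finite F"
    using finite_subset[of F "Pow (vertices G)"] sub finV by auto
  let ?E = "\<lambda>W. real (card {e \<in> F. e \<subseteq> W})" and ?t = "real (card W)"
  have "?E W \<le> ?t * (1 + g ?t)"
  proof (cases "?t \<le> 2 * s")
    case True
    then have "?E W \<le> ?t"
      using small less.prems by simp
    also have "\<dots> \<le> ?t * (1 + g ?t)"
      using g_nonneg[of ?t] by (simp add: distrib_left)
    finally show ?thesis .
  next
    case False
    then have t: "?t > 2 * s" by simp
    then have "card W > 2"
      using \<open>s \<ge> 1\<close> by linarith
    then obtain S where S: "S \<subseteq> W" "1 \<le> card S" "real (card S) \<le> ?t / 2"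
      and cut: "real (card {e \<in> F. e \<subseteq> W \<and> card (e \<inter> S) = 1}) \<le> f ?t * real (card S)"
      using non_expanding_sparse_cut[OF ne G less.prems F] by blast
    have finW: "finite W"
      using less.prems finV finite_subset by blast
    have cardWS: "card (W - S) = card W - card S" "card S \<le> card W"
      using S(1) finW by (auto simp: card_Diff_subset finite_subset card_mono)
    let ?a = "real (card S)" and ?b = "real (card (W - S))"
    have ab: "?b = ?t - ?a"
      using cardWS by simp
    have "card S < card W" "card (W - S) < card W"
      using S(2,3) cardWS by linarith+
    then have IH: "?E S \<le> ?a * (1 + g ?a)" "?E (W - S) \<le> ?b * (1 + g ?b)"
      using less.hyps[of S] less.hyps[of "W - S"] less.prems S(1) by (auto simp: g_def)
    \<comment> \<open>Here the threshold \<open>2 * s\<close> matters: it puts \<open>?t / 2\<close>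
      above \<open>s\<close>, hence above \<open>max s ?a\<close>.\<close>
    have "P (?t / 2) \<le> P (max s ?a)"
      using t S(3) by (intro anti) auto
    then have "g ?a + f ?t \<le> g ?t"
      using tele[OF t] t \<open>s \<ge> 1\<close> by (simp add: g_def max_def)
    then have "?a * (g ?a + f ?t) \<le> ?a * g ?t"
      by (intro mult_left_mono) auto
    \<comment> \<open>The larger side is not charged for the cut, so monotonicity of
      \<open>g\<close> suffices.\<close>
    moreover have "?b * g ?b \<le> ?b * g ?t"
      using ab by (intro mult_left_mono g_mono) auto
    moreover have "?E W \<le> ?E S + ?E (W - S) + f ?t * ?a"
      using card_induced_edges_split[OF finF two, of W S] cut by simp
    ultimately have "?E W \<le> ?a + ?b + ?a * g ?t + ?b * g ?t"
      using IH by (simp add: algebra_simps)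
    then show ?thesis
      by (simp add: ab algebra_simps)
  qed
  then show ?case
    by (simp add: g_def)
qed

section \<open>Exploring a ball\<close>

primrec ask :: "(nat \<times> nat) list \<Rightarrow> ((nat \<times> nat) list \<Rightarrow> computation) \<Rightarrow> computation" where
  "ask [] c = c []"
| "ask (p # ps) c = Query (fst p) (snd p) (\<lambda>r. ask ps (\<lambda>as.
     c (case r of None \<Rightarrow> as | Some y \<Rightarrow> (fst p, y) # as)))"

text \<open>Vertices seen earlier stay in the list, which matches the reflexive closure in
  \<open>sparsify\<close>. Repetitions are kept as well, so costs are counted with
  multiplicity.\<close>

primrec explore ::
  "(nat \<Rightarrow> nat \<Rightarrow> bool) \<Rightarrow> nat \<Rightarrow> nat \<Rightarrow> nat list \<Rightarrow> (nat list \<Rightarrow> computation) \<Rightarrow> computation"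
  where
  "explore P d 0 xs c = c xs"
| "explore P d (Suc m) xs c = ask (List.product xs [1..<Suc d])
     (\<lambda>as. explore P d m (xs @ map snd (filter (\<lambda>(x, y). P x y) as)) c)"

lemma ask_run:
  "\<exists>as. answer orc (ask ps c) = answer orc (c as) \<and>
        queries orc (ask ps c) = ps @ queries orc (c as) \<and>
        set as = {(x, y). \<exists>i. (x, i) \<in> set ps \<and> orc x i = Some y} \<and>
        length as \<le> length ps"
proof (induction ps arbitrary: c)
  case (Cons p ps)
  let ?c = "\<lambda>as. c (case orc (fst p) (snd p) of None \<Rightarrow> as | Some y \<Rightarrow> (fst p, y) # as)"
  obtain as where as: "answer orc (ask ps ?c) = answer orc (?c as)"
    "queries orc (ask ps ?c) = ps @ queries orc (?c as)"
    "set as = {(x, y). \<exists>i. (x, i) \<in> set ps \<and> orc x i = Some y}"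
    "length as \<le> length ps"
    using Cons.IH[of ?c] by blast
  show ?case
  proof (cases "orc (fst p) (snd p)")
    case None
    then show ?thesis
      using as by (intro exI[of _ as]) auto
  next
    case (Some y)
    then show ?thesis
      using as by (intro exI[of _ "(fst p, y) # as"]) (auto, (metis prod.collapse)+)
  qed
qed simp

text \<open>A round on a list of length \<open>l\<close> costs \<open>l * d\<close> queries and
  leaves a list of length at most \<open>l * (1 + d)\<close>; the total is a geometric sum.\<close>

lemma explore_run:
  assumes orc: "\<And>x. x \<in> V \<Longrightarrow> {y. \<exists>i\<in>{1..d}. orc x i = Some y} = N x"
    and N: "\<And>x. x \<in> V \<Longrightarrow> N x \<subseteq> V"
    and "set xs \<subseteq> V"
  shows "\<exists>ys qs. answer orc (explore P d m xs c) = answer orc (c ys) \<and>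
        queries orc (explore P d m xs c) = qs @ queries orc (c ys) \<and>
        set ys = ({(x, y). y \<in> N x \<and> P x y}\<^sup>= ^^ m) `` set xs \<and>
        set qs \<subseteq> V \<times> {1..d} \<and>
        length qs \<le> length xs * ((1 + d) ^ m - 1)"
  using assms(3)
proof (induction m arbitrary: xs)
  case (Suc m)
  let ?R = "{(x, y). y \<in> N x \<and> P x y}"
  let ?ps = "List.product xs [1..<Suc d]"
  let ?next = "\<lambda>as. xs @ map snd (filter (\<lambda>(x, y). P x y) as)"
  let ?c = "\<lambda>as. explore P d m (?next as) c"
  obtain as where as: "answer orc (ask ?ps ?c) = answer orc (?c as)"
    "queries orc (ask ?ps ?c) = ?ps @ queries orc (?c as)"
    "set as = {(x, y). \<exists>i. (x, i) \<in> set ?ps \<and> orc x i = Some y}"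
    "length as \<le> length ?ps"
    using ask_run[of orc ?ps ?c] by blast
  have "set as = {(x, y). x \<in> set xs \<and> (\<exists>i\<in>{1..d}. orc x i = Some y)}"
    unfolding as(3) by auto
  also have "\<dots> = {(x, y). x \<in> set xs \<and> y \<in> N x}"
    using orc Suc.prems by blast
  finally have set_next: "set (?next as) = ?R\<^sup>= `` set xs"
    by force
  then have "set (?next as) \<subseteq> V"
    using Suc.prems N by auto
  then obtain ys qs where IH: "answer orc (?c as) = answer orc (c ys)"
    "queries orc (?c as) = qs @ queries orc (c ys)"
    "set ys = (?R\<^sup>= ^^ m) `` set (?next as)" "set qs \<subseteq> V \<times> {1..d}"
    "length qs \<le> length (?next as) * ((1 + d) ^ m - 1)"
    using Suc.IH by blast
  have "length (filter (\<lambda>(x, y). P x y) as) \<le> length xs * d"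
    using le_trans[OF length_filter_le as(4)] by (simp del: upt_Suc)
  then have "length (?next as) \<le> length xs * (1 + d)"
    by simp
  then have "length qs \<le> length xs * (1 + d) * ((1 + d) ^ m - 1)"
    using IH(5) mult_le_mono1 le_trans by blast
  \<comment> \<open>Writing the power as a successor removes the truncated subtraction.\<close>
  moreover obtain p where p: "(1 + d) ^ m = Suc p"
    by (metis add_is_0 not0_implies_Suc one_neq_zero power_not_zero)
  ultimately have len: "length (?ps @ qs) \<le> length xs * ((1 + d) ^ Suc m - 1)"
    by (simp add: algebra_simps del: upt_Suc)
  have "(?R\<^sup>= ^^ Suc m) `` set xs = (?R\<^sup>= ^^ m) `` (?R\<^sup>= `` set xs)"
    by (metis relcomp_Image relpow.simps(2) relpow_commute)
  then have "set ys = (?R\<^sup>= ^^ Suc m) `` set xs"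
    using IH(3) set_next by simp
  moreover have "set (?ps @ qs) \<subseteq> V \<times> {1..d}"
    using Suc.prems IH(4) by auto
  ultimately show ?case
    using as(1,2) IH(1,2) len by (intro exI[of _ ys] exI[of _ "?ps @ qs"]) simp
qed auto

definition kruskal_algorithm :: "nat \<Rightarrow> local_algorithm" where
  "kruskal_algorithm k \<omega> n d e = (case e of (u, v) \<Rightarrow>
     explore (\<lambda>x y. set_encode {x, y} < set_encode {u, v}) d k [u] (\<lambda>xs. Answer (v \<notin> set xs)))"

lemma kruskal_algorithm_run:
  fixes \<omega> :: coins and n k :: nat
  assumes G: "simple_graph G" "max_degree_at_most G d" and adj: "incidence_lists G adj"
    and uv: "{u, v} \<in> edges G"
  defines "orc \<equiv> incidence_oracle adj" and "T \<equiv> kruskal_algorithm k \<omega> n d (u, v)"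
  shows "answer orc T \<longleftrightarrow> {u, v} \<in> sparsify k (edges G)"
    and "set (queries orc T) \<subseteq> vertices G \<times> {1..d}"
    and "length (queries orc T) \<le> (1 + d) ^ k"
proof -
  have N: "neighbours G x \<subseteq> vertices G" for x
    using G(1) by (auto simp: simple_graph_def neighbours_def)
  have orc: "{y. \<exists>i\<in>{1..d}. orc x i = Some y} = neighbours G x" if "x \<in> vertices G" for x
  proof -
    have adjx: "distinct (adj x)" "set (adj x) = neighbours G x"
      using adj that by (auto simp: incidence_lists_def)
    then have len: "length (adj x) \<le> d"
      using G(2) that distinct_card[of "adj x"] by (auto simp: max_degree_at_most_def)
    have "(\<exists>i\<in>{1..d}. orc x i = Some y) \<longleftrightarrow> y \<in> set (adj x)" for y
    proof
      assume "\<exists>i\<in>{1..d}. orc x i = Some y"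
      then show "y \<in> set (adj x)"
        by (auto simp: orc_def incidence_oracle_def split: if_splits)
    next
      assume "y \<in> set (adj x)"
      then obtain j where "j < length (adj x)" "y = adj x ! j"
        by (auto simp: in_set_conv_nth)
      \<comment> \<open>The oracle counts neighbours from 1, list positions start at 0.\<close>
      then show "\<exists>i\<in>{1..d}. orc x i = Some y"
        using len by (intro bexI[of _ "Suc j"]) (auto simp: orc_def incidence_oracle_def)
    qed
    then show ?thesis
      using adjx(2) by auto
  qed
  have u: "set [u] \<subseteq> vertices G"
    using G(1) uv by (auto simp: simple_graph_def)
  let ?P = "\<lambda>x y. set_encode {x, y} < set_encode {u, v}"
  have R: "{(x, y). y \<in> neighbours G x \<and> ?P x y} = light_arcs (edges G) (set_encode {u, v})"
    by (auto simp: neighbours_def light_arcs_def)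
  obtain ys qs where run: "answer orc T = (v \<notin> set ys)" "queries orc T = qs"
    "set ys = ((light_arcs (edges G) (set_encode {u, v}))\<^sup>= ^^ k) `` {u}"
    "set qs \<subseteq> vertices G \<times> {1..d}" "length qs \<le> (1 + d) ^ k - 1"
    using explore_run[of "vertices G" d orc "neighbours G" "[u]" ?P k
        "\<lambda>xs. Answer (v \<notin> set xs)", OF orc N u]
    unfolding R T_def kruskal_algorithm_def by auto
  show "answer orc T \<longleftrightarrow> {u, v} \<in> sparsify k (edges G)"
    using run(1,3) uv by (simp add: sparsify_iff)
  show "set (queries orc T) \<subseteq> vertices G \<times> {1..d}" "length (queries orc T) \<le> (1 + d) ^ k"
    using run(2,4,5) by auto
qed

section \<open>The spanning graph algorithm\<close>

lemma measure_coin_space_UNIV: "measure coin_space UNIV = 1"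
proof -
  interpret prob_space coin_space
    unfolding coin_space_def by (intro prob_space_PiM prob_space_measure_pmf)
  have "space coin_space = UNIV"
    by (simp add: coin_space_def space_PiM)
  then show ?thesis
    using prob_space by simp
qed

theorem theorem3p1:
  fixes C :: real
  assumes "C > 0"
  shows "\<exists>q :: real \<Rightarrow> nat \<Rightarrow> nat. \<forall>\<epsilon>>0. \<exists>A.
           deterministic A \<and>
           local_sparse_spanning_graph_algorithm \<epsilon> (q \<epsilon>)
             {G. non_expanding (\<lambda>x. C / (log 2 x * (log 2 (log 2 x))\<^sup>2)) G} A"
proof -
  \<comment> \<open>The choice of \<open>m\<close> gives
    \<open>C / m \<epsilon> < \<epsilon>\<close>; the double exponential makes
    \<open>log 2 (log 2 (s \<epsilon>))\<close> equal to \<open>m \<epsilon>\<close>; and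
    \<open>k\<close> is the walk length required by \<open>card_sparsify_small\<close> for sets of
    up to \<open>2 * s \<epsilon>\<close> vertices.\<close>
  define m :: "real \<Rightarrow> nat" where "m \<epsilon> = nat \<lceil>2 * C / \<epsilon>\<rceil> + 1" for \<epsilon>
  define s :: "real \<Rightarrow> nat" where "s \<epsilon> = 2 ^ 2 ^ m \<epsilon>" for \<epsilon>
  define k :: "real \<Rightarrow> nat" where "k \<epsilon> = (2 * s \<epsilon>)\<^sup>2" for \<epsilon>
  define f where "f = (\<lambda>x. C / (log 2 x * (log 2 (log 2 x))\<^sup>2))"
  define P where "P x = C / log 2 (log 2 x)" for x
  have main: "local_sparse_spanning_graph_algorithm \<epsilon> (\<lambda>d. (1 + d) ^ k \<epsilon>)
      {G. non_expanding f G} (kruskal_algorithm (k \<epsilon>))" if "\<epsilon> > 0" for \<epsilon>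
    unfolding local_sparse_spanning_graph_algorithm_def
  proof (intro allI impI ballI, elim conjE)
    fix n d :: nat and G
    assume "n \<ge> 1" and "G \<in> {G. non_expanding f G}" and G: "simple_graph G" "vertices G = {1..n}"
      "connected_graph G" "max_degree_at_most G d"
    then have ne: "non_expanding f G" by simp
    define F where "F = sparsify (k \<epsilon>) (edges G)"
    have two: "\<And>e. e \<in> edges G \<Longrightarrow> card e = 2" and sub: "\<And>e. e \<in> edges G \<Longrightarrow> e \<subseteq> {1..n}"
      using G by (auto simp: simple_graph_def)
    have F: "F \<subseteq> edges G"
      by (simp add: F_def sparsify_subset)
    \<comment> \<open>From \<open>s \<epsilon> \<ge> 4\<close> on, the iterated logarithm is at
      least 1, so \<open>P\<close> is positive and antitone there, and the telescoping bound
      applies.\<close>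
    have "2 ^ 1 \<le> (2::nat) ^ m \<epsilon>"
      by (intro power_increasing) (auto simp: m_def)
    then have "2 ^ 2 \<le> s \<epsilon>"
      unfolding s_def by (intro power_increasing) auto
    then have s4: "real (s \<epsilon>) \<ge> 4"
      by simp
    have loglog: "log 2 x \<ge> 2" "log 2 (log 2 x) \<ge> 1" if "x \<ge> real (s \<epsilon>)" for x
    proof -
      show "log 2 x \<ge> 2"
        using that s4 by (simp add: le_log_iff)
      then show "log 2 (log 2 x) \<ge> 1"
        by (simp add: le_log_iff)
    qed
    have anti: "P y \<le> P x" if "real (s \<epsilon>) \<le> x" "x \<le> y" for x y
    proof -
      have "log 2 (log 2 x) \<le> log 2 (log 2 y)"
        using that loglog[of x] s4 by (intro log_mono) auto
      moreover have "0 < log 2 (log 2 x)"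
        using loglog(2)[of x] that by linarith
      ultimately show ?thesis
        unfolding P_def using assms by (intro divide_left_mono mult_pos_pos) linarith+
    qed
    have "real (card {e \<in> F. e \<subseteq> {1..n}})
        \<le> real (card {1..n}) * (1 + (P (real (s \<epsilon>)) - P (max (real (s \<epsilon>)) (real (card {1..n})))))"
    proof (rule card_edges_non_expanding[OF ne G(1) F])
      fix W assume W: "W \<subseteq> vertices G" "real (card W) \<le> 2 * real (s \<epsilon>)"
      then have "card W \<le> 2 * s \<epsilon>" by linarith
      then have "(card W)\<^sup>2 \<le> k \<epsilon>"
        unfolding k_def by (intro power_mono) auto
      then show "card {e \<in> F. e \<subseteq> W} \<le> card W"
        unfolding F_def using W(1) G(2) two
        by (intro card_sparsify_small) (auto intro: finite_subset)
    next
      fix t assume "t > 2 * real (s \<epsilon>)"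
      then show "f t \<le> P (t / 2) - P t"
        unfolding f_def P_def using s4 assms by (intro expansion_bound_telescopes) auto
    qed (use s4 anti G(2) in auto)
    also have "\<dots> \<le> real n * (1 + P (s \<epsilon>))"
    proof -
      have "P (max (real (s \<epsilon>)) (real n)) \<ge> 0"
        using assms loglog(2)[of "max (real (s \<epsilon>)) (real n)"] by (simp add: P_def)
      then show ?thesis by (simp add: mult_left_mono)
    qed
    also have "\<dots> < real n * (1 + \<epsilon>)"
    proof -
      have "2 * C / \<epsilon> < real (m \<epsilon>)"
        unfolding m_def by linarith
      then have "2 * C < \<epsilon> * real (m \<epsilon>)"
        using that by (simp add: divide_less_eq mult.commute)
      moreover have "P (s \<epsilon>) = C / m \<epsilon>"
        by (simp add: P_def s_def log_nat_power)
      ultimately have "P (s \<epsilon>) < \<epsilon>"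
        using assms by (simp add: m_def divide_less_eq)
      then show ?thesis
        using \<open>n \<ge> 1\<close> by simp
    qed
    also have "{e \<in> F. e \<subseteq> {1..n}} = F"
      using F sub by auto
    finally have card_F: "real (card F) < (1 + \<epsilon>) * real n"
      by (simp add: mult.commute)
    show "\<exists>E' :: coins \<Rightarrow> nat set set.
           (\<forall>\<omega>. E' \<omega> \<subseteq> edges G \<and>
                connected_graph \<lparr>vertices = {1..n}, edges = E' \<omega>\<rparr>) \<and>
           measure coin_space {\<omega>. real (card (E' \<omega>)) < (1 + \<epsilon>) * real n} \<ge> 2 / 3 \<and>
           (\<forall>\<omega> adj u v. incidence_lists G adj \<and> {u, v} \<in> edges G \<longrightarrow>
              (let orc = incidence_oracle adj; T = kruskal_algorithm (k \<epsilon>) \<omega> n d (u, v) in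
                 (answer orc T \<longleftrightarrow> {u, v} \<in> E' \<omega>) \<and>
                 set (queries orc T) \<subseteq> {1..n} \<times> {1..d} \<and>
                 length (queries orc T) \<le> (1 + d) ^ k \<epsilon>))"
    proof (intro exI[of _ "\<lambda>_. F"] conjI allI impI)
      show "connected_graph \<lparr>vertices = {1..n}, edges = F\<rparr>"
        using connected_graph_sparsify[OF G(3)] by (simp add: F_def G(2))
      \<comment> \<open>The edge set is the same for all coins, so the event is the whole
        space.\<close>
      show "measure coin_space {\<omega>. real (card F) < (1 + \<epsilon>) * real n} \<ge> 2 / 3"
        using card_F by (simp add: measure_coin_space_UNIV)
      fix \<omega> adj u v
      assume "incidence_lists G adj \<and> {u, v} \<in> edges G"
      then show "let orc = incidence_oracle adj; T = kruskal_algorithm (k \<epsilon>) \<omega> n d (u, v) in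
                 (answer orc T \<longleftrightarrow> {u, v} \<in> F) \<and>
                 set (queries orc T) \<subseteq> {1..n} \<times> {1..d} \<and>
                 length (queries orc T) \<le> (1 + d) ^ k \<epsilon>"
        using kruskal_algorithm_run[OF G(1,4), of adj u v "k \<epsilon>" \<omega> n]
        unfolding Let_def F_def G(2) by blast
    qed (rule F)
  qed
  have "deterministic (kruskal_algorithm (k \<epsilon>))" for \<epsilon>
    by (simp add: deterministic_def kruskal_algorithm_def fun_eq_iff)
  then show ?thesis
    using main unfolding f_def by (intro exI[of _ "\<lambda>\<epsilon> d. (1 + d) ^ k \<epsilon>"]) blast
qed

end
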